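(* Let $\lambda>0,\gamma>0,\varepsilon>0$ and let $f_{L,\gamma,\lambda}:\mathbb{R}\to\mathbb{R}_{\ge 0}$ be the Minimax Logarithmic Concave Penalty (MLCP) function $$f_{L,\gamma,\lambda}(z)=\begin{cases}\lambda\log\left(\frac{|z|}{\varepsilon}+1\right)-\frac{1}{2\gamma}\log^{2}\left(\frac{|z|}{\varepsilon}+1\right), & |z|\le \varepsilon e^{\gamma\lambda}-\varepsilon,\\[2pt] \frac{\gamma\lambda^{2}}{2}, & |z|>\varepsilon e^{\gamma\lambda}-\varepsilon.\end{cases}$$ Considered on $[0,+\infty)$, it satisfies the following properties: (a) $f_{L,\gamma,\lambda}(z)$ is continuous, smooth, and $f_{L,\gamma,\lambda}(0)=0$, $\lim_{z\to+\infty} \frac{f_{L,\gamma,\lambda}(z)}{z}=0$; (b) $f_{L,\gamma,\lambda}(z)$ is monotonically non-decreasing and concave on $[0,+\infty)$; (c) $f'_{L,\gamma,\lambda}(z)$ is non-negative and monotonically non-increasing on $[0,+\infty)$. Moreover, it is Lipschitz bounded, i.e., there exists a constant $L(f)$ such that $|f'_{L,\gamma,\lambda}(x)-f'_{L,\gamma,\lambda}(y)|\le L(f)\,|x-y|$; (d) the MLCP function is increasing in the parameter $\gamma$, and $$\lim_{\gamma\to+\infty} f_{L,\gamma,\lambda}(z)=\lambda\log\left(\frac{|z|}{\varepsilon}+1\right).$$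
   Context: $\log$ is the natural logarithm. The MLCP function is symmetric (even), so its properties are discussed only on $[0,+\infty)$. *)

theory Defs
  imports "HOL-Analysis.Analysis"
begin

definition mlcp :: "real \<Rightarrow> real \<Rightarrow> real \<Rightarrow> real \<Rightarrow> real" where
  "mlcp \<epsilon> \<gamma> lam z =
    (if \<bar>z\<bar> \<le> \<epsilon> * exp (\<gamma> * lam) - \<epsilon>
     then lam * ln (\<bar>z\<bar> / \<epsilon> + 1) - 1 / (2 * \<gamma>) * (ln (\<bar>z\<bar> / \<epsilon> + 1))\<^sup>2
     else \<gamma> * lam\<^sup>2 / 2)"

text \<open>
  Derivative of the restriction of \<open>f\<close> to \<open>S\<close>. On the half-line \<open>{0..}\<close> it is the
  ordinary derivative at \<open>z > 0\<close> and the right derivative at \<open>0\<close>, where the even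
  function \<open>mlcp\<close> has a kink and so no two-sided derivative. As \<open>vector_derivative\<close> is a
  choice operator, it is meaningful only together with differentiability, which \<open>C1_on\<close>
  asserts.
\<close>
definition deriv_on :: "real set \<Rightarrow> (real \<Rightarrow> real) \<Rightarrow> real \<Rightarrow> real" where
  "deriv_on S f z = vector_derivative f (at z within S)"

text \<open>
  Smoothness is meant as continuous differentiability: the second derivative of \<open>mlcp\<close>
  jumps at \<open>\<bar>z\<bar> = \<epsilon> * exp (\<gamma> * lam) - \<epsilon>\<close>.
\<close>
definition C1_on :: "real set \<Rightarrow> (real \<Rightarrow> real) \<Rightarrow> bool" where
  "C1_on S f \<longleftrightarrow> f differentiable_on S \<and> continuous_on S (deriv_on S f)"

lemma mlcp_even: "mlcp \<epsilon> \<gamma> lam (- z) = mlcp \<epsilon> \<gamma> lam z"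
  by (simp add: mlcp_def)

lemma mlcp_nonneg:
  assumes "lam > 0" "\<gamma> > 0" "\<epsilon> > 0"
  shows "mlcp \<epsilon> \<gamma> lam z \<ge> 0"
proof (cases "\<bar>z\<bar> \<le> \<epsilon> * exp (\<gamma> * lam) - \<epsilon>")
  case True
  define l where "l = ln (\<bar>z\<bar> / \<epsilon> + 1)"
  have "\<bar>z\<bar> / \<epsilon> + 1 \<le> exp (\<gamma> * lam)"
    using True assms by (simp add: field_simps)
  moreover have ge1: "\<bar>z\<bar> / \<epsilon> + 1 \<ge> 1" using assms by simp
  ultimately have "l \<le> \<gamma> * lam"
    unfolding l_def by (metis ln_exp ln_mono less_le_trans zero_less_one)
  moreover have "l \<ge> 0" using ge1 by (simp add: l_def)
  ultimately have "l * l \<le> (\<gamma> * lam) * l" by (simp add: mult_right_mono)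
  also have "\<dots> \<le> 2 * \<gamma> * lam * l" using assms \<open>l \<ge> 0\<close> by simp
  finally have "1 / (2 * \<gamma>) * l\<^sup>2 \<le> lam * l"
    using assms by (simp add: field_simps power2_eq_square)
  then show ?thesis using True by (simp add: mlcp_def l_def)
next
  case False
  then show ?thesis using assms by (simp add: mlcp_def)
qed

end

theory Submission imports Defs begin

text \<open>
  With \<open>l = ln (\<bar>z\<bar> / \<epsilon> + 1)\<close>, completing the square turns both branches into the single formula
  \<open>\<gamma> lam\<^sup>2 / 2 - \<gamma> / 2 (max 0 (lam - l / \<gamma>))\<^sup>2\<close>. Since the square of the positive part is \<open>C\<^sup>1\<close>,
  so is the penalty on \<open>{0..}\<close>, with derivative \<open>max 0 (lam - l / \<gamma>) / (\<epsilon> + z)\<close>, a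
  product of two nonnegative, antitone, bounded and Lipschitz functions.
  The penalty is also the maximum of \<open>lam t - t\<^sup>2 / (2 \<gamma>)\<close> over \<open>0 \<le> t \<le> min l (\<gamma> lam)\<close>,
  attained at the right end, which gives monotonicity in \<open>\<gamma>\<close>.
\<close>

section \<open>Closed forms of the penalty\<close>

text \<open>Away from 0 the function is locally \<open>0\<close> or the square; at 0 its difference
  quotient is \<open>max 0 h\<close>, which tends to 0. Hence the branches of the penalty join
  without a kink.\<close>

lemma DERIV_max_0_power2:
  "((\<lambda>t::real. (max 0 t)\<^sup>2) has_real_derivative 2 * max 0 t) (at t)"
  unfolding DERIV_def
proof -
  consider "t < 0" | "t = 0" | "t > 0" by linarith
  then show "((\<lambda>h. ((max 0 (t + h))\<^sup>2 - (max 0 t)\<^sup>2) / h) \<longlongrightarrow> 2 * max 0 t) (at 0)"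
  proof cases
    case 1
    have "((\<lambda>t. 0) has_real_derivative 0) (at t)" by simp
    then have "((\<lambda>t. (max 0 t)\<^sup>2) has_real_derivative 0) (at t)"
      by (rule has_field_derivative_transform_within_open[where S = "{..<0}"]) (use 1 in auto)
    then show ?thesis using 1 by (simp add: DERIV_def)
  next
    case 2
    have "((\<lambda>h. max 0 h) \<longlongrightarrow> max 0 (0::real)) (at 0)"
      by (intro tendsto_intros)
    moreover have "(max 0 h)\<^sup>2 / h = max 0 h" for h :: real
      by (auto simp: max_def power2_eq_square)
    ultimately show ?thesis using 2 by simp
  next
    case 3
    have "((\<lambda>t. t\<^sup>2) has_real_derivative 2 * t) (at t)"
      by (auto intro!: derivative_eq_intros)
    then have "((\<lambda>t. (max 0 t)\<^sup>2) has_real_derivative 2 * t) (at t)"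
      by (rule has_field_derivative_transform_within_open[where S = "{0<..}"]) (use 3 in auto)
    then show ?thesis using 3 by (simp add: DERIV_def)
  qed
qed

lemma ln_abs_div_le_iff:
  fixes \<epsilon> a z :: real
  assumes "\<epsilon> > 0"
  shows "ln (\<bar>z\<bar> / \<epsilon> + 1) \<le> a \<longleftrightarrow> \<bar>z\<bar> \<le> \<epsilon> * exp a - \<epsilon>"
proof -
  have "\<bar>z\<bar> / \<epsilon> + 1 > 0" using assms by (simp add: add_nonneg_pos)
  then have "ln (\<bar>z\<bar> / \<epsilon> + 1) \<le> a \<longleftrightarrow> \<bar>z\<bar> / \<epsilon> + 1 \<le> exp a"
    by (metis exp_le_cancel_iff exp_ln)
  also have "\<dots> \<longleftrightarrow> \<bar>z\<bar> \<le> \<epsilon> * exp a - \<epsilon>"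
    using assms by (simp add: field_simps)
  finally show ?thesis .
qed

lemma mlcp_eq_ln_cases:
  assumes "\<epsilon> > 0"
  shows "mlcp \<epsilon> \<gamma> lam z =
    (if ln (\<bar>z\<bar> / \<epsilon> + 1) \<le> \<gamma> * lam
     then lam * ln (\<bar>z\<bar> / \<epsilon> + 1) - (ln (\<bar>z\<bar> / \<epsilon> + 1))\<^sup>2 / (2 * \<gamma>)
     else \<gamma> * lam\<^sup>2 / 2)"
  unfolding mlcp_def ln_abs_div_le_iff[OF assms] by simp

lemma mlcp_eq_square:
  assumes "\<gamma> > 0" "\<epsilon> > 0"
  shows "mlcp \<epsilon> \<gamma> lam z
    = \<gamma> * lam\<^sup>2 / 2 - \<gamma> / 2 * (max 0 (lam - ln (\<bar>z\<bar> / \<epsilon> + 1) / \<gamma>))\<^sup>2"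
proof (cases "ln (\<bar>z\<bar> / \<epsilon> + 1) \<le> \<gamma> * lam")
  case True
  define l where "l = ln (\<bar>z\<bar> / \<epsilon> + 1)"
  have "max 0 (lam - l / \<gamma>) = lam - l / \<gamma>"
    using True assms by (simp add: field_simps max_def l_def)
  moreover have "mlcp \<epsilon> \<gamma> lam z = lam * l - l\<^sup>2 / (2 * \<gamma>)"
    using True assms by (simp add: mlcp_eq_ln_cases l_def)
  moreover have "lam * l - l\<^sup>2 / (2 * \<gamma>) = \<gamma> * lam\<^sup>2 / 2 - \<gamma> / 2 * (lam - l / \<gamma>)\<^sup>2"
    using assms by (simp add: field_simps power2_eq_square)
  ultimately show ?thesis by (simp add: l_def)
next
  case False
  then have "max 0 (lam - ln (\<bar>z\<bar> / \<epsilon> + 1) / \<gamma>) = 0"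
    using assms by (simp add: field_simps)
  then show ?thesis
    using False assms by (simp add: mlcp_eq_ln_cases)
qed

text \<open>The quadratic in \<open>t\<close> is \<open>\<gamma> * lam\<^sup>2 / 2\<close> minus a
  multiple of the square of \<open>lam - t / \<gamma>\<close>. The two upper bounds on
  \<open>t\<close> say exactly that this number dominates both arguments of the \<open>max\<close>
  in the closed form.\<close>

lemma mlcp_ge:
  assumes "\<gamma> > 0" "\<epsilon> > 0" "t \<le> ln (\<bar>z\<bar> / \<epsilon> + 1)" "t \<le> \<gamma> * lam"
  shows "lam * t - t\<^sup>2 / (2 * \<gamma>) \<le> mlcp \<epsilon> \<gamma> lam z"
proof -
  let ?p = "max 0 (lam - ln (\<bar>z\<bar> / \<epsilon> + 1) / \<gamma>)"
  have "?p \<le> lam - t / \<gamma>"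
    using assms by (auto simp: field_simps)
  then have "?p\<^sup>2 \<le> (lam - t / \<gamma>)\<^sup>2"
    by (intro power_mono) auto
  then have "\<gamma> / 2 * ?p\<^sup>2 \<le> \<gamma> / 2 * (lam - t / \<gamma>)\<^sup>2"
    using assms by (intro mult_left_mono) auto
  moreover have "lam * t - t\<^sup>2 / (2 * \<gamma>) = \<gamma> * lam\<^sup>2 / 2 - \<gamma> / 2 * (lam - t / \<gamma>)\<^sup>2"
    using assms by (simp add: field_simps power2_eq_square)
  ultimately show ?thesis
    using assms by (simp add: mlcp_eq_square)
qed

text \<open>The bound of \<open>mlcp_ge\<close> is attained at the largest admissible
  \<open>t\<close>. On the flat branch this is the vertex \<open>\<gamma> * lam\<close> of the
  parabola.\<close>

lemma mlcp_eq_min: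
  assumes "\<gamma> > 0" "\<epsilon> > 0"
  shows "mlcp \<epsilon> \<gamma> lam z = lam * min (ln (\<bar>z\<bar> / \<epsilon> + 1)) (\<gamma> * lam)
    - (min (ln (\<bar>z\<bar> / \<epsilon> + 1)) (\<gamma> * lam))\<^sup>2 / (2 * \<gamma>)"
proof (cases "ln (\<bar>z\<bar> / \<epsilon> + 1) \<le> \<gamma> * lam")
  case True
  then show ?thesis
    using assms by (simp add: mlcp_eq_ln_cases)
next
  case False
  have "\<gamma> * lam\<^sup>2 / 2 = lam * (\<gamma> * lam) - (\<gamma> * lam)\<^sup>2 / (2 * \<gamma>)"
    using assms by (simp add: field_simps power2_eq_square)
  then show ?thesis
    using False assms by (simp add: mlcp_eq_ln_cases)
qed

lemma mlcp_0: "\<gamma> > 0 \<Longrightarrow> lam > 0 \<Longrightarrow> \<epsilon> > 0 \<Longrightarrow> mlcp \<epsilon> \<gamma> lam 0 = 0"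
  by (simp add: mlcp_def)

section \<open>Dependence on \<gamma> and growth at infinity\<close>

lemma strict_mono_on_mlcp_gamma:
  assumes "lam > 0" "\<epsilon> > 0" "z \<noteq> 0"
  shows "strict_mono_on {0<..} (\<lambda>g. mlcp \<epsilon> g lam z)"
proof (rule strict_mono_onI)
  fix g h :: real
  assume gh: "g \<in> {0<..}" "h \<in> {0<..}" "g < h"
  \<comment> \<open>The maximiser for \<open>g\<close>; it stays admissible for the larger
    \<open>h\<close>, where the quadratic has a smaller negative term.\<close>
  define t where "t = min (ln (\<bar>z\<bar> / \<epsilon> + 1)) (g * lam)"
  have "\<bar>z\<bar> / \<epsilon> > 0" using assms by simp
  then have "ln (\<bar>z\<bar> / \<epsilon> + 1) > 0" by (intro ln_gt_zero) linarith
  \<comment> \<open>Positivity of \<open>t\<close>, which comes from \<open>z \<noteq> 0\<close>,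
    makes the comparison of the quadratic terms strict.\<close>
  then have "t > 0" using assms gh by (simp add: t_def)
  then have "t\<^sup>2 / (2 * h) < t\<^sup>2 / (2 * g)"
    using gh by (intro divide_strict_left_mono) auto
  then have "mlcp \<epsilon> g lam z < lam * t - t\<^sup>2 / (2 * h)"
    using gh assms by (simp add: mlcp_eq_min t_def)
  also have "\<dots> \<le> mlcp \<epsilon> h lam z"
  proof (rule mlcp_ge)
    have "g * lam \<le> h * lam" using gh assms by simp
    then show "t \<le> h * lam" by (simp add: t_def)
  qed (use gh assms in \<open>auto simp: t_def\<close>)
  finally show "mlcp \<epsilon> g lam z < mlcp \<epsilon> h lam z" .
qed

lemma mono_on_mlcp_gamma:
  assumes "lam > 0" "\<epsilon> > 0"
  shows "mono_on {0<..} (\<lambda>g. mlcp \<epsilon> g lam z)"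
proof (cases "z = 0")
  case True
  then show ?thesis using assms by (auto intro!: mono_onI simp: mlcp_0)
next
  case False
  then show ?thesis
    using assms strict_mono_on_mlcp_gamma strict_mono_on_imp_mono_on by blast
qed

lemma tendsto_mlcp_gamma:
  assumes "lam > 0" "\<epsilon> > 0"
  shows "((\<lambda>g. mlcp \<epsilon> g lam z) \<longlongrightarrow> lam * ln (\<bar>z\<bar> / \<epsilon> + 1)) at_top"
proof -
  define l where "l = ln (\<bar>z\<bar> / \<epsilon> + 1)"
  have "((\<lambda>g. l\<^sup>2 / 2 / g) \<longlongrightarrow> 0) at_top"
    by (intro real_tendsto_divide_at_top[OF tendsto_const filterlim_ident])
  then have "((\<lambda>g. lam * l - l\<^sup>2 / 2 / g) \<longlongrightarrow> lam * l - 0) at_top"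
    by (intro tendsto_intros) simp
  moreover have "\<forall>\<^sub>F g in at_top. lam * l - l\<^sup>2 / 2 / g = mlcp \<epsilon> g lam z"
    \<comment> \<open>Once \<open>g\<close> reaches \<open>l / lam\<close>, the fixed
      \<open>z\<close> lies on the logarithmic branch.\<close>
    using eventually_ge_at_top[of "l / lam"]
  proof eventually_elim
    case (elim g)
    then have "l \<le> g * lam" using assms by (simp add: field_simps)
    then show ?case
      using assms by (simp add: mlcp_eq_ln_cases l_def)
  qed
  ultimately show ?thesis
    unfolding l_def by (auto intro: Lim_transform_eventually)
qed

lemma tendsto_mlcp_over_id:
  "((\<lambda>z. mlcp \<epsilon> \<gamma> lam z / z) \<longlongrightarrow> 0) at_top"
proof -
  have "((\<lambda>z. \<gamma> * lam\<^sup>2 / 2 / z) \<longlongrightarrow> 0) at_top"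
    by (intro real_tendsto_divide_at_top[OF tendsto_const filterlim_ident])
  moreover have "\<forall>\<^sub>F z in at_top. \<gamma> * lam\<^sup>2 / 2 / z = mlcp \<epsilon> \<gamma> lam z / z"
    using eventually_gt_at_top[of "\<epsilon> * exp (\<gamma> * lam) - \<epsilon>"]
  proof eventually_elim
    case (elim z)
    then have "\<not> \<bar>z\<bar> \<le> \<epsilon> * exp (\<gamma> * lam) - \<epsilon>" by linarith
    then show ?case by (simp add: mlcp_def)
  qed
  ultimately show ?thesis
    by (auto intro: Lim_transform_eventually)
qed

section \<open>General facts on concavity and Lipschitz products\<close>

lemma concave_on_realI:
  fixes f f' :: "real \<Rightarrow> real"
  assumes "connected S"
    and "\<And>x. x \<in> S \<Longrightarrow> (f has_real_derivative f' x) (at x)"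
    and "antimono_on S f'"
  shows "concave_on S f"
  unfolding concave_on_def
proof (rule convex_on_realI)
  show "((\<lambda>x. - f x) has_real_derivative - f' x) (at x)" if "x \<in> S" for x
    using assms(2)[OF that] by (rule DERIV_minus)
qed (use assms in \<open>auto simp: monotone_on_def\<close>)

text \<open>The product rule for differences: change one factor at a time, bounding the other by
  \<open>A\<close> or \<open>B\<close>.\<close>

lemma lipschitz_on_mult_bounded:
  fixes f g :: "'a::metric_space \<Rightarrow> 'b::real_normed_algebra"
  assumes "C-lipschitz_on S f" "D-lipschitz_on S g"
    and "\<And>x. x \<in> S \<Longrightarrow> norm (f x) \<le> A" "\<And>x. x \<in> S \<Longrightarrow> norm (g x) \<le> B" "A \<ge> 0" "B \<ge> 0"
  shows "(A * D + C * B)-lipschitz_on S (\<lambda>x. f x * g x)"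
proof (rule lipschitz_onI)
  have CD: "C \<ge> 0" "D \<ge> 0"
    using assms lipschitz_on_nonneg by blast+
  then show "0 \<le> A * D + C * B" using assms by simp
  fix x y assume xy: "x \<in> S" "y \<in> S"
  have "f x * g x - f y * g y = f x * (g x - g y) + (f x - f y) * g y"
    by (simp add: algebra_simps)
  then have "norm (f x * g x - f y * g y)
      \<le> norm (f x) * norm (g x - g y) + norm (f x - f y) * norm (g y)"
    by (simp only:) (intro norm_triangle_le add_mono norm_mult_ineq)
  also have "\<dots> \<le> A * (D * dist x y) + (C * dist x y) * B"
    using assms xy CD lipschitz_onD[OF assms(1) xy] lipschitz_onD[OF assms(2) xy]
    by (intro add_mono mult_mono) (auto simp: dist_norm)
  finally show "dist (f x * g x) (f y * g y) \<le> (A * D + C * B) * dist x y"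
    by (simp add: dist_norm algebra_simps)
qed

section \<open>First-order behaviour on the half-line\<close>

context
  fixes lam \<gamma> \<epsilon> :: real
  assumes pos: "lam > 0" "\<gamma> > 0" "\<epsilon> > 0"
begin

text \<open>The derivative of the penalty with respect to \<open>ln (z / \<epsilon> + 1)\<close>.
  The chain rule supplies the remaining factor \<open>inverse (\<epsilon> + z)\<close>.\<close>

definition mlcp_slope :: "real \<Rightarrow> real" where
  "mlcp_slope z = max 0 (lam - ln (z / \<epsilon> + 1) / \<gamma>)"

text \<open>
  Dropping the absolute value from \<open>mlcp\<close> removes the kink at \<open>0\<close>, so the derivative
  on \<open>{0..}\<close> becomes two-sided.
\<close>
definition mlcp_ext :: "real \<Rightarrow> real" where
  "mlcp_ext z = \<gamma> * lam\<^sup>2 / 2 - \<gamma> / 2 * (mlcp_slope z)\<^sup>2"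

lemma mlcp_eq_ext: "z \<ge> 0 \<Longrightarrow> mlcp \<epsilon> \<gamma> lam z = mlcp_ext z"
  using pos by (simp add: mlcp_eq_square mlcp_ext_def mlcp_slope_def)

lemma DERIV_mlcp_ext:
  assumes "z \<ge> 0"
  shows "(mlcp_ext has_real_derivative mlcp_slope z * inverse (\<epsilon> + z)) (at z)"
proof -
  have z: "z / \<epsilon> + 1 > 0" "\<epsilon> + z > 0"
    using assms pos by (simp_all add: add_nonneg_pos)
  have "((\<lambda>z. lam - ln (z / \<epsilon> + 1) / \<gamma>) has_real_derivative - inverse (\<epsilon> + z) / \<gamma>) (at z)"
    using z pos by (auto intro!: derivative_eq_intros simp: divide_simps)
  from DERIV_chain2[OF DERIV_max_0_power2 this]
  have "((\<lambda>z. (mlcp_slope z)\<^sup>2) has_real_derivative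
      2 * mlcp_slope z * (- inverse (\<epsilon> + z) / \<gamma>)) (at z)"
    by (simp add: mlcp_slope_def)
  from DERIV_diff[OF DERIV_const[of "\<gamma> * lam\<^sup>2 / 2"] DERIV_cmult[OF this, of "\<gamma> / 2"]]
  have "((\<lambda>z. \<gamma> * lam\<^sup>2 / 2 - \<gamma> / 2 * (mlcp_slope z)\<^sup>2) has_real_derivative
      mlcp_slope z * inverse (\<epsilon> + z)) (at z)"
    using pos by simp
  then show ?thesis unfolding mlcp_ext_def .
qed

lemma DERIV_mlcp:
  assumes "z \<ge> 0"
  shows "(mlcp \<epsilon> \<gamma> lam has_real_derivative mlcp_slope z * inverse (\<epsilon> + z)) (at z within {0..})"
  using DERIV_subset[OF DERIV_mlcp_ext[OF assms] subset_UNIV, of "{0..}"] assms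
  by (auto intro: has_field_derivative_transform_within[of _ _ _ _ 1] simp: mlcp_eq_ext)

lemma deriv_on_mlcp:
  assumes "z \<ge> 0"
  shows "deriv_on {0..} (mlcp \<epsilon> \<gamma> lam) z = mlcp_slope z * inverse (\<epsilon> + z)"
proof -
  \<comment> \<open>A nontrivial filter makes the derivative unique, so the choice operator in
    \<open>deriv_on\<close> must return it. At every \<open>z\<close> of the half-line, 0 included,
    the right neighbourhoods suffice.\<close>
  have "at z within {0..} \<noteq> bot"
    using at_le[of "{z<..}" "{0..}" z] trivial_limit_at_right_real[of z] assms
    by (force simp: bot_unique)
  then show ?thesis
    using DERIV_mlcp[OF assms] unfolding deriv_on_def
    by (simp add: has_real_derivative_iff_has_vector_derivative vector_derivative_within)
qed

lemma mlcp_slope_nonneg: "mlcp_slope z \<ge> 0"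
  by (simp add: mlcp_slope_def)

lemma mlcp_slope_antimono: "0 \<le> x \<Longrightarrow> x \<le> y \<Longrightarrow> mlcp_slope y \<le> mlcp_slope x"
  unfolding mlcp_slope_def using pos
  by (intro max.mono diff_mono divide_right_mono ln_mono) (auto simp: add_nonneg_pos divide_right_mono)

lemma antimono_on_slope_mult: "antimono_on {0..} (\<lambda>z. mlcp_slope z * inverse (\<epsilon> + z))"
  using pos
  by (intro monotone_onI mult_mono mlcp_slope_antimono mlcp_slope_nonneg le_imp_inverse_le) auto

lemma mlcp_slope_lipschitz: "(1 / (\<epsilon> * \<gamma>))-lipschitz_on {0..} mlcp_slope"
proof (rule lipschitz_onI)
  \<comment> \<open>For ordered arguments only this sign needs an estimate; antitonicity makes the
    difference nonnegative.\<close>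
  have *: "mlcp_slope x - mlcp_slope y \<le> 1 / (\<epsilon> * \<gamma>) * (y - x)" if "0 \<le> x" "x \<le> y" for x y
  proof -
    have p: "x / \<epsilon> + 1 > 0" "y / \<epsilon> + 1 > 0"
      using pos that by (intro add_nonneg_pos divide_nonneg_pos; simp)+
    have "ln (y / \<epsilon> + 1) - ln (x / \<epsilon> + 1) \<le> (y / \<epsilon> + 1 - (x / \<epsilon> + 1)) / (x / \<epsilon> + 1)"
      by (rule ln_diff_le[OF p(2,1)])
    \<comment> \<open>The denominator \<open>x / \<epsilon> + 1\<close> is at least 1 on the
      half-line.\<close>
    also have "\<dots> \<le> (y / \<epsilon> + 1 - (x / \<epsilon> + 1)) / 1"
      using that pos p by (intro divide_left_mono) (auto simp: divide_right_mono)
    finally have "ln (y / \<epsilon> + 1) - ln (x / \<epsilon> + 1) \<le> (y - x) / \<epsilon>"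
      by (simp add: diff_divide_distrib)
    then have "(ln (y / \<epsilon> + 1) - ln (x / \<epsilon> + 1)) / \<gamma> \<le> (y - x) / \<epsilon> / \<gamma>"
      using pos by (intro divide_right_mono) auto
    moreover have "0 \<le> (y - x) / \<epsilon> / \<gamma>" using that pos by simp
    ultimately show ?thesis
      unfolding mlcp_slope_def by (auto simp: max_def diff_divide_distrib)
  qed
  show "dist (mlcp_slope x) (mlcp_slope y) \<le> 1 / (\<epsilon> * \<gamma>) * dist x y"
    if "x \<in> {0..}" "y \<in> {0..}" for x y
    using that *[of x y] *[of y x] mlcp_slope_antimono[of x y] mlcp_slope_antimono[of y x]
    by (cases "x \<le> y") (auto simp: dist_real_def)
qed (use pos in simp)

lemma inverse_add_lipschitz: "(1 / \<epsilon>\<^sup>2)-lipschitz_on {0..} (\<lambda>z. inverse (\<epsilon> + z))"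
proof (rule lipschitz_onI)
  fix x y :: real assume xy: "x \<in> {0..}" "y \<in> {0..}"
  have "inverse (\<epsilon> + x) - inverse (\<epsilon> + y) = (y - x) / ((\<epsilon> + x) * (\<epsilon> + y))"
    using xy pos by (simp add: field_simps)
  then have "dist (inverse (\<epsilon> + x)) (inverse (\<epsilon> + y)) = dist x y / ((\<epsilon> + x) * (\<epsilon> + y))"
    using xy pos by (simp add: dist_real_def abs_mult abs_minus_commute)
  also have "\<dots> \<le> dist x y / (\<epsilon> * \<epsilon>)"
    using xy pos by (intro divide_left_mono mult_mono mult_pos_pos) auto
  finally show "dist (inverse (\<epsilon> + x)) (inverse (\<epsilon> + y)) \<le> 1 / \<epsilon>\<^sup>2 * dist x y"
    by (simp add: power2_eq_square)
qed simp

lemma deriv_on_mlcp_lipschitz: "\<exists>L. L-lipschitz_on {0..} (deriv_on {0..} (mlcp \<epsilon> \<gamma> lam))"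
proof -
  have "norm (mlcp_slope z) \<le> lam" if "z \<in> {0..}" for z
    using mlcp_slope_antimono[of 0 z] that pos by (simp add: mlcp_slope_def)
  moreover have "norm (inverse (\<epsilon> + z)) \<le> inverse \<epsilon>" if "z \<in> {0..}" for z
    using that pos by (simp add: le_imp_inverse_le)
  \<comment> \<open>The slope is at most its value \<open>lam\<close> at 0, and the inverse at most
    its value \<open>inverse \<epsilon>\<close> there; these are the bounds \<open>A\<close> and
    \<open>B\<close>.\<close>
  ultimately have L: "(lam * (1 / \<epsilon>\<^sup>2) + 1 / (\<epsilon> * \<gamma>) * inverse \<epsilon>)-lipschitz_on {0..}
      (\<lambda>z. mlcp_slope z * inverse (\<epsilon> + z))"
    using pos mlcp_slope_lipschitz inverse_add_lipschitz by (intro lipschitz_on_mult_bounded) auto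
  show ?thesis
    by (rule exI, rule lipschitz_on_transform[OF L]) (simp add: deriv_on_mlcp)
qed

lemma C1_on_mlcp: "C1_on {0..} (mlcp \<epsilon> \<gamma> lam)"
  unfolding C1_on_def
proof
  show "mlcp \<epsilon> \<gamma> lam differentiable_on {0..}"
    unfolding differentiable_on_def
    using DERIV_mlcp by (meson atLeast_iff differentiableI has_field_derivative_def)
  show "continuous_on {0..} (deriv_on {0..} (mlcp \<epsilon> \<gamma> lam))"
    using deriv_on_mlcp_lipschitz lipschitz_on_continuous_on by blast
qed

lemma mono_on_mlcp: "mono_on {0..} (mlcp \<epsilon> \<gamma> lam)"
proof (rule mono_onI)
  fix x y :: real assume "x \<in> {0..}" "y \<in> {0..}" "x \<le> y"
  then show "mlcp \<epsilon> \<gamma> lam x \<le> mlcp \<epsilon> \<gamma> lam y"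
    using mlcp_slope_antimono[of x y] mlcp_slope_nonneg pos
    by (auto simp: mlcp_eq_ext mlcp_ext_def intro!: mult_left_mono power_mono)
qed

text \<open>The derivative criterion asks for two-sided derivatives even at the endpoint 0, so it is
  applied to \<open>mlcp_ext\<close>. Concavity carries over because convex combinations of points
  of \<open>{0..}\<close> stay in \<open>{0..}\<close>, where both functions agree.\<close>

lemma concave_on_mlcp: "concave_on {0..} (mlcp \<epsilon> \<gamma> lam)"
proof -
  have "concave_on {0..} mlcp_ext"
    using DERIV_mlcp_ext antimono_on_slope_mult by (intro concave_on_realI) auto
  then show ?thesis
    by (auto simp: concave_on_iff mlcp_eq_ext)
qed

end

theorem proposition1:
  fixes lam \<gamma> \<epsilon> :: real
  assumes "lam > 0" and "\<gamma> > 0" and "\<epsilon> > 0"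
  shows
    "(continuous_on {0..} (mlcp \<epsilon> \<gamma> lam)
      \<and> C1_on {0..} (mlcp \<epsilon> \<gamma> lam)
      \<and> mlcp \<epsilon> \<gamma> lam 0 = 0
      \<and> ((\<lambda>z. mlcp \<epsilon> \<gamma> lam z / z) \<longlongrightarrow> 0) at_top)
   \<and> (mono_on {0..} (mlcp \<epsilon> \<gamma> lam)
      \<and> concave_on {0..} (mlcp \<epsilon> \<gamma> lam))
   \<and> ((\<forall>z\<in>{0..}. deriv_on {0..} (mlcp \<epsilon> \<gamma> lam) z \<ge> 0)
      \<and> antimono_on {0..} (deriv_on {0..} (mlcp \<epsilon> \<gamma> lam))
      \<and> (\<exists>L. L-lipschitz_on {0..} (deriv_on {0..} (mlcp \<epsilon> \<gamma> lam))))
   \<and> ((\<forall>z. mono_on {0<..} (\<lambda>g. mlcp \<epsilon> g lam z))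
      \<and> (\<forall>z. z \<noteq> 0 \<longrightarrow> strict_mono_on {0<..} (\<lambda>g. mlcp \<epsilon> g lam z))
      \<and> (\<forall>z. ((\<lambda>g. mlcp \<epsilon> g lam z) \<longlongrightarrow> lam * ln (\<bar>z\<bar> / \<epsilon> + 1)) at_top))"
proof -
  have "continuous_on {0..} (mlcp \<epsilon> \<gamma> lam)"
    using C1_on_mlcp[OF assms] differentiable_imp_continuous_on by (auto simp: C1_on_def)
  moreover have "\<forall>z\<in>{0..}. deriv_on {0..} (mlcp \<epsilon> \<gamma> lam) z \<ge> 0"
    using assms mlcp_slope_nonneg[OF assms] by (simp add: deriv_on_mlcp)
  moreover have "antimono_on {0..} (deriv_on {0..} (mlcp \<epsilon> \<gamma> lam))"
    using antimono_on_slope_mult[OF assms] by (simp add: monotone_on_def deriv_on_mlcp[OF assms])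
  ultimately show ?thesis
    using C1_on_mlcp[OF assms] mlcp_0[OF assms(2,1,3)] tendsto_mlcp_over_id
      mono_on_mlcp[OF assms] concave_on_mlcp[OF assms] deriv_on_mlcp_lipschitz[OF assms]
      mono_on_mlcp_gamma[OF assms(1,3)] strict_mono_on_mlcp_gamma[OF assms(1,3)]
      tendsto_mlcp_gamma[OF assms(1,3)]
    by blast
qed

end
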